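(* Let $G$ be a finite simple graph, let $f:V(G)\rightarrow\mathbb{Z}^+$ be an even integer-valued function with $f(v)\geq 4$ for all $v$, and let $H_f(v)=\{1,3,\ldots,f(v)-1,f(v)\}$. Let $(A_{H_f},B_{H_f},C_{H_f},D_{H_f})$ be the $H_f$-decomposition of $G$. Then (a) $E_G(B_{H_f},B_{H_f}\cup C_{H_f})=\emptyset$; (b) for every component $R$ of $G[D_{H_f}]$, $|V(R)|+|E_G(V(R),B_{H_f})|\equiv 1\pmod 2$; (c) every component of $G[D_{H_f}\cup B_{H_f}]$ has odd order.
   Context: For a set function $H$ on $G$ (assigning a set of nonnegative integers to each vertex), let $\nabla_H(F)=\sum_{v}\min\{|d_F(v)-h|: h\in H(v)\}$ for spanning subgraphs $F$, $\nabla(H)$ its minimum over spanning subgraphs, and $F$ is $H$-optimal if $\nabla_H(F)=\nabla(H)$. Let $I_H(v)=\{d_F(v): F\ H\text{-optimal}\}$, $MH(v)=\max H(v)$, $mH(v)=\min H(v)$. The $H$-decomposition is $C_H=\{v: I_H(v)\subseteq H(v)\}$, $A_H=\{v\notin C_H: \min I_H(v)\geq MH(v)\}$, $B_H=\{v\notin C_H:\max I_H(v)\leq mH(v)\}$, $D_H=V(G)\setminus(A_H\cup B_H\cup C_H)$. $E_G(S,T)$ denotes the set of edges with one end in $S$ and the other in $T$. *)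

theory Defs
  imports Main
begin

text \<open>A finite simple graph is given by its vertex set \<open>V\<close> and its edge set \<open>E\<close>, the edges being
  two-element subsets of \<open>V\<close>.  A spanning subgraph is identified with its edge set \<open>F \<subseteq> E\<close>.\<close>

definition finite_simple_graph :: "'a set \<Rightarrow> 'a set set \<Rightarrow> bool" where
  "finite_simple_graph V E \<longleftrightarrow> finite V \<and> (\<forall>e\<in>E. e \<subseteq> V \<and> card e = 2)"

definition degree :: "'a set set \<Rightarrow> 'a \<Rightarrow> nat" where
  "degree F v = card {e \<in> F. v \<in> e}"

definition edges_between :: "'a set set \<Rightarrow> 'a set \<Rightarrow> 'a set \<Rightarrow> 'a set set" where
  "edges_between E S T = {e \<in> E. \<exists>u\<in>S. \<exists>v\<in>T. e = {u, v}}"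

definition induced_edges :: "'a set set \<Rightarrow> 'a set \<Rightarrow> 'a set set" where
  "induced_edges E S = {e \<in> E. e \<subseteq> S}"

definition adjacency :: "'a set set \<Rightarrow> ('a \<times> 'a) set" where
  "adjacency E = {(u, v). {u, v} \<in> E}"

text \<open>The components of a graph are represented by their vertex sets.\<close>

definition components :: "'a set \<Rightarrow> 'a set set \<Rightarrow> 'a set set" where
  "components V E = {{u \<in> V. (v, u) \<in> (adjacency E)\<^sup>*} | v. v \<in> V}"

abbreviation induced_components :: "'a set set \<Rightarrow> 'a set \<Rightarrow> 'a set set" where
  "induced_components E S \<equiv> components S (induced_edges E S)"

text \<open>Set functions \<open>H\<close> are meant to assign a finite nonempty set to every vertex of the graph;
  \<^const>\<open>Min\<close> and \<^const>\<open>Max\<close> of \<open>H v\<close> are unspecified otherwise.\<close>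

definition nabla :: "'a set \<Rightarrow> ('a \<Rightarrow> nat set) \<Rightarrow> 'a set set \<Rightarrow> int" where
  "nabla V H F = (\<Sum>v\<in>V. Min {\<bar>int (degree F v) - int h\<bar> | h. h \<in> H v})"

definition nabla_min :: "'a set \<Rightarrow> 'a set set \<Rightarrow> ('a \<Rightarrow> nat set) \<Rightarrow> int" where
  "nabla_min V E H = Min {nabla V H F | F. F \<subseteq> E}"

definition H_optimal :: "'a set \<Rightarrow> 'a set set \<Rightarrow> ('a \<Rightarrow> nat set) \<Rightarrow> 'a set set \<Rightarrow> bool" where
  "H_optimal V E H F \<longleftrightarrow> F \<subseteq> E \<and> nabla V H F = nabla_min V E H"

definition I_H :: "'a set \<Rightarrow> 'a set set \<Rightarrow> ('a \<Rightarrow> nat set) \<Rightarrow> 'a \<Rightarrow> nat set" where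
  "I_H V E H v = {degree F v | F. H_optimal V E H F}"

definition C_H :: "'a set \<Rightarrow> 'a set set \<Rightarrow> ('a \<Rightarrow> nat set) \<Rightarrow> 'a set" where
  "C_H V E H = {v \<in> V. I_H V E H v \<subseteq> H v}"

definition A_H :: "'a set \<Rightarrow> 'a set set \<Rightarrow> ('a \<Rightarrow> nat set) \<Rightarrow> 'a set" where
  "A_H V E H = {v \<in> V. v \<notin> C_H V E H \<and> Min (I_H V E H v) \<ge> Max (H v)}"

definition B_H :: "'a set \<Rightarrow> 'a set set \<Rightarrow> ('a \<Rightarrow> nat set) \<Rightarrow> 'a set" where
  "B_H V E H = {v \<in> V. v \<notin> C_H V E H \<and> Max (I_H V E H v) \<le> Min (H v)}"

definition D_H :: "'a set \<Rightarrow> 'a set set \<Rightarrow> ('a \<Rightarrow> nat set) \<Rightarrow> 'a set" where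
  "D_H V E H = V - (A_H V E H \<union> B_H V E H \<union> C_H V E H)"

definition H_of :: "('a \<Rightarrow> nat) \<Rightarrow> 'a \<Rightarrow> nat set" where
  "H_of f v = {h. odd h \<and> h \<le> f v - 1} \<union> {f v}"

end

theory Submission
  imports Defs
begin

text \<open>Call \<open>v\<close> low in \<open>F\<close> if its degree is even and below \<open>f v\<close>, and let \<open>X\<close> be the set of vertices
  that are low in some optimal subgraph. Exchanging trails in the symmetric difference of two optimal
  subgraphs show that vertices of \<open>X\<close> have degree below \<open>f v\<close> in all optimal subgraphs, and that a vertex
  outside \<open>X\<close> whose degree ever exceeds \<open>f v\<close> has degree at least \<open>f v\<close> in all of them. Hence
  \<open>X = D \<union> B\<close>. Flipping an edge of \<open>G[X]\<close> at a low vertex keeps the subgraph optimal and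
  moves the low vertex to the other end, like a token. Two tokens in one component of \<open>G[X]\<close> could
  be moved next to each other and then removed, so a component contains at most one. Moving the
  token to an end of an edge that leaves the component decides whether that edge is in \<open>F\<close>: edges
  from \<open>X\<close> to its complement never are (and lead to \<open>A\<close>), edges from \<open>D\<close> to \<open>B\<close> always are. The
  parity statements follow from the handshake lemma, since all vertices of the component but the
  token have odd degree.\<close>

section \<open>Distance of a degree to the admissible values\<close>

text \<open>The distance of the degree \<open>d\<close> to \<open>{1, 3, \<dots>, k - 1, k}\<close>, for even \<open>k\<close>.\<close>

definition penalty :: "int \<Rightarrow> int \<Rightarrow> int" where
  "penalty k d = (if d < k then (if even d then 1 else 0) else d - k)"

abbreviation deg :: "'a set set \<Rightarrow> 'a \<Rightarrow> int" where
  "deg F v \<equiv> int (degree F v)"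

text \<open>Below \<open>f v\<close> the odd numbers are admissible and each even one has an
  admissible successor; from \<open>f v\<close> on, the maximum \<open>f v\<close> is
  nearest.\<close>

lemma Min_dist_H_of:
  assumes "even (f v)" "f v \<ge> 4"
  shows "Min {\<bar>int d - int h\<bar> | h. h \<in> H_of f v} = penalty (int (f v)) (int d)"
proof (rule Min_eqI)
  have "H_of f v \<subseteq> {..f v}" by (auto simp: H_of_def)
  then have "finite (H_of f v)" by (rule finite_subset) simp
  then show "finite {\<bar>int d - int h\<bar> | h. h \<in> H_of f v}" by simp
next
  fix y assume "y \<in> {\<bar>int d - int h\<bar> | h. h \<in> H_of f v}"
  then obtain h where h: "y = \<bar>int d - int h\<bar>" "h = f v \<or> odd h \<and> h \<le> f v - 1"
    by (auto simp: H_of_def)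
  have "y \<noteq> 0" if "d < f v" "even d"
    using h that by auto
  then show "penalty (int (f v)) (int d) \<le> y"
    using h assms(2) by (auto simp: penalty_def)
next
  define h where "h = (if d < f v then (if odd d then d else d + 1) else f v)"
  have "h \<in> H_of f v"
    using assms by (auto simp: h_def H_of_def)
  moreover have "penalty (int (f v)) (int d) = \<bar>int d - int h\<bar>"
    by (auto simp: h_def penalty_def)
  ultimately show "penalty (int (f v)) (int d) \<in> {\<bar>int d - int h\<bar> | h. h \<in> H_of f v}"
    by blast
qed

text \<open>The case without change is the step from \<open>k - 1\<close> to \<open>k\<close>, the
  only two consecutive admissible values. Every other unit step changes the distance by exactly one,
  which the later case analyses exploit.\<close>

lemma penalty_up:
  assumes "even k"
  shows "penalty k (a + 1) - penalty k a = (if a \<ge> k then 1 else if even a then - 1 else if a + 1 = k then 0 else 1)"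
  using assms by (auto simp: penalty_def)

lemma penalty_down:
  assumes "even k"
  shows "penalty k (b - 1) - penalty k b = (if b > k then - 1 else if b = k then 0 else if even b then - 1 else 1)"
  using assms by (auto simp: penalty_def)

text \<open>For \<open>d = k + 1\<close> the two steps pass \<open>k\<close> and end at the
  admissible \<open>k - 1\<close>.\<close>

lemma penalty_minus_2: "even k \<Longrightarrow> d > k \<Longrightarrow> penalty k (d - 2) < penalty k d"
  by (cases "d = k + 1") (auto simp: penalty_def)

text \<open>Needed for trails that return to their start. By parity \<open>d + 2\<close> cannot jump
  over \<open>k\<close>, and landing on \<open>k\<close> would give distance 0.\<close>

lemma penalty_plus_2:
  assumes "even k" "even d" "d < k" "1 \<le> penalty k (d + 2)"
  shows "d + 2 < k" "penalty k (d + 2) = 1"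
proof -
  have "d + 1 \<noteq> k" using assms(1,2) by auto
  then show "d + 2 < k" using assms by (cases "d + 2 = k") (auto simp: penalty_def)
  then show "penalty k (d + 2) = 1" using assms by (simp add: penalty_def)
qed

section \<open>Flipping edges and its effect on degrees\<close>

definition flip :: "'a set set \<Rightarrow> 'a set set \<Rightarrow> 'a set set" where
  "flip F T = sym_diff F T"

lemma deg_flip:
  assumes "finite F" "finite T"
  shows "deg (flip F T) v = deg F v + deg (T - F) v - deg (F \<inter> T) v"
proof -
  have "card {e \<in> flip F T. v \<in> e} + card {e \<in> F \<inter> T. v \<in> e}
      = card ({e \<in> flip F T. v \<in> e} \<union> {e \<in> F \<inter> T. v \<in> e})"
    by (rule card_Un_disjoint [symmetric]) (use assms in \<open>auto simp: flip_def\<close>)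
  also have "{e \<in> flip F T. v \<in> e} \<union> {e \<in> F \<inter> T. v \<in> e} = {e \<in> F. v \<in> e} \<union> {e \<in> T - F. v \<in> e}"
    by (auto simp: flip_def)
  also have "card \<dots> = card {e \<in> F. v \<in> e} + card {e \<in> T - F. v \<in> e}"
    by (rule card_Un_disjoint) (use assms in auto)
  finally show ?thesis by (simp add: degree_def)
qed

text \<open>Each edge of \<open>T\<close> lies in exactly one of \<open>F\<close> and
  \<open>G\<close>, and flipping moves it to the other. One trail thus changes the two subgraphs in
  opposite ways.\<close>

lemma deg_flip_balance:
  assumes "finite F" "finite G" "T \<subseteq> flip F G"
  shows "deg (flip F T) v + deg (flip G T) v = deg F v + deg G v"
proof -
  have "finite T" using assms by (metis finite_Diff finite_UnI finite_subset flip_def)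
  moreover have "T - F = G \<inter> T" "T - G = F \<inter> T" using assms(3) by (auto simp: flip_def)
  ultimately show ?thesis using assms(1,2) deg_flip[of F T v] deg_flip[of G T v] by simp
qed

lemma deg_empty: "deg {} v = 0"
  by (simp add: degree_def)

lemma deg_singleton: "deg {e} v = (if v \<in> e then 1 else 0)"
proof -
  have "{e' \<in> {e}. v \<in> e'} = (if v \<in> e then {e} else {})" by auto
  then show ?thesis by (simp add: degree_def)
qed

lemma deg_flip_edge:
  assumes "finite F"
  shows "deg (flip F {e}) v = deg F v + (if v \<in> e then (if e \<in> F then - 1 else 1) else 0)"
proof (cases "e \<in> F")
  case True
  then have "{e} - F = {}" "F \<inter> {e} = {e}" by auto
  then show ?thesis using deg_flip[OF assms, of "{e}" v] True by (simp only: finite.intros deg_singleton deg_empty) simp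
next
  case False
  then have "{e} - F = {e}" "F \<inter> {e} = {}" by auto
  then show ?thesis using deg_flip[OF assms, of "{e}" v] False by (simp only: finite.intros deg_singleton deg_empty) simp
qed

lemma ex_edge_of_deg_less:
  assumes "finite F" "deg F v < deg G v"
  shows "\<exists>e \<in> G - F. v \<in> e"
proof (rule ccontr)
  assume "\<not> ?thesis"
  then have "card {e \<in> G. v \<in> e} \<le> card {e \<in> F. v \<in> e}"
    by (intro card_mono) (use assms(1) in auto)
  then show False using assms(2) by (simp add: degree_def)
qed

lemma neq_add_odd: "odd s \<Longrightarrow> even (a + b) \<Longrightarrow> b \<noteq> a + s" for a b s :: int
  by auto

lemma even_add_shift: "odd s \<Longrightarrow> b = a + s \<Longrightarrow> odd (c + b) \<Longrightarrow> even (c + a)" for a b c s :: int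
  by auto

lemma odd_penalty_step:
  assumes "even k" "even d" "0 \<le> d" "d < k" "s = 1 \<or> s = - 1"
  shows "penalty k (d + s) = 0" "penalty k d = 1" "odd (d + s)" "d + s < k"
proof -
  show "penalty k d = 1" using assms by (simp add: penalty_def)
  show "odd (d + s)" using assms by auto
  then show "penalty k (d + s) = 0" using assms by (auto simp: penalty_def)
  have "d + 1 \<noteq> k" using assms by auto
  then show "d + s < k" using assms by auto
qed

text \<open>Handshake argument: an edge contributes the number of its ends in \<open>R\<close>,
  which is 0, 1 or 2, so only edges with one end in \<open>R\<close> affect the parity.\<close>

lemma even_sum_degree_iff:
  assumes "finite R" "finite F" "\<And>e. e \<in> F \<Longrightarrow> card e = 2"
  shows "even (\<Sum>v\<in>R. degree F v) \<longleftrightarrow> even (card {e \<in> F. card (e \<inter> R) = 1})"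
proof -
  have "(\<Sum>v\<in>R. degree F v) = (\<Sum>v\<in>R. \<Sum>e\<in>F. if v \<in> e then 1 else 0)"
    using assms(2) by (simp add: degree_def sum.If_cases Int_def)
  also have "\<dots> = (\<Sum>e\<in>F. \<Sum>v\<in>R. if v \<in> e then 1 else 0)"
    by (rule sum.swap)
  also have "\<dots> = (\<Sum>e\<in>F. card (e \<inter> R))"
    using assms(1) by (simp add: sum.If_cases Int_def conj_commute)
  finally have "even (\<Sum>v\<in>R. degree F v) \<longleftrightarrow> even (card {e \<in> F. odd (card (e \<inter> R))})"
    using even_sum_iff[OF assms(2)] by simp
  moreover have "odd (card (e \<inter> R)) \<longleftrightarrow> card (e \<inter> R) = 1" if "e \<in> F" for e
  proof -
    have "finite e" using assms(3)[OF that] card.infinite by fastforce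
    then have "card (e \<inter> R) \<le> 2" using assms(3)[OF that] by (metis card_mono inf_le1)
    then have "card (e \<inter> R) = 0 \<or> card (e \<inter> R) = 1 \<or> card (e \<inter> R) = 2" by linarith
    then show ?thesis by auto
  qed
  then have "{e \<in> F. odd (card (e \<inter> R))} = {e \<in> F. card (e \<inter> R) = 1}" by (simp cong: conj_cong)
  ultimately show ?thesis by simp
qed

section \<open>Optimal subgraphs for fixed \<open>V\<close>, \<open>E\<close> and
  \<open>f\<close>\<close>

locale even_bound_graph =
  fixes V :: "'a set" and E :: "'a set set" and f :: "'a \<Rightarrow> nat"
  assumes graph: "finite_simple_graph V E"
    and f_even: "\<And>v. v \<in> V \<Longrightarrow> even (f v)"
    and f_ge: "\<And>v. v \<in> V \<Longrightarrow> f v \<ge> 4"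
begin

abbreviation k :: "'a \<Rightarrow> int" where "k v \<equiv> int (f v)"
abbreviation nab :: "'a set set \<Rightarrow> int" where "nab \<equiv> nabla V (H_of f)"
abbreviation opt :: "'a set set \<Rightarrow> bool" where "opt \<equiv> H_optimal V E (H_of f)"
abbreviation m :: int where "m \<equiv> nabla_min V E (H_of f)"

definition low :: "'a set set \<Rightarrow> 'a \<Rightarrow> bool" where
  "low F v \<longleftrightarrow> even (deg F v) \<and> deg F v < k v"

lemma finite_V: "finite V" and edge_sub: "e \<in> E \<Longrightarrow> e \<subseteq> V" and card_edge: "e \<in> E \<Longrightarrow> card e = 2"
  using graph by (auto simp: finite_simple_graph_def)

lemma finite_E: "finite E"
  using finite_V edge_sub by (meson Pow_iff finite_Pow_iff finite_subset subsetI)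

lemma finite_sub: "F \<subseteq> E \<Longrightarrow> finite F"
  using finite_E finite_subset by blast

lemma edge_at:
  assumes "e \<in> E" "x \<in> e"
  obtains w where "e = {x, w}" "w \<noteq> x" "w \<in> V" "x \<in> V"
proof -
  have "card e = 2" using assms card_edge by blast
  then obtain a b where "e = {a, b}" "a \<noteq> b" by (auto simp: card_2_iff)
  then show ?thesis using assms edge_sub[OF assms(1)] that by (cases "x = a") auto
qed

lemma k_props: "v \<in> V \<Longrightarrow> even (k v) \<and> k v \<ge> 4"
  using f_even f_ge by fastforce

lemma nab_eq: "nab F = (\<Sum>v\<in>V. penalty (k v) (deg F v))"
  unfolding nabla_def by (rule sum.cong) (simp_all add: Min_dist_H_of f_even f_ge)

lemma m_le: "F \<subseteq> E \<Longrightarrow> m \<le> nab F"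
  and optD: "opt F \<Longrightarrow> F \<subseteq> E \<and> nab F = m"
  and optI: "F \<subseteq> E \<Longrightarrow> nab F \<le> m \<Longrightarrow> opt F"
proof -
  have fin: "finite {nab F | F. F \<subseteq> E}" using finite_E by simp
  show le: "m \<le> nab F" if "F \<subseteq> E" for F
    unfolding nabla_min_def by (rule Min_le[OF fin]) (use that in blast)
  show "opt F \<Longrightarrow> F \<subseteq> E \<and> nab F = m" by (simp add: H_optimal_def)
  show "F \<subseteq> E \<Longrightarrow> nab F \<le> m \<Longrightarrow> opt F" using le[of F] by (simp add: H_optimal_def)
qed

lemma ex_opt: "\<exists>F. opt F"
proof -
  have "m \<in> {nab F | F. F \<subseteq> E}"
    unfolding nabla_min_def by (rule Min_in) (use finite_E in auto)
  then obtain F where "F \<subseteq> E" "nab F = m" by auto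
  then show ?thesis using optI[of F] by auto
qed


section \<open>Trails in the symmetric difference of two subgraphs\<close>

lemma nab_change:
  assumes "P \<subseteq> V" and "\<And>v. v \<in> V - P \<Longrightarrow> penalty (k v) (deg G v) = penalty (k v) (deg F v)"
  shows "nab G = nab F + (\<Sum>v\<in>P. penalty (k v) (deg G v) - penalty (k v) (deg F v))"
proof -
  have "(\<Sum>v\<in>V. penalty (k v) (deg G v) - penalty (k v) (deg F v))
      = (\<Sum>v\<in>P. penalty (k v) (deg G v) - penalty (k v) (deg F v))"
    by (rule sum.mono_neutral_right) (use finite_V assms in auto)
  then show ?thesis by (simp add: nab_eq sum_subtractf)
qed

text \<open>The set \<open>T\<close> is the edge set of a trail from \<open>x\<close> to \<open>y\<close> that usually alternates between
  \<open>F\<close> and \<open>F'\<close>, but may take two consecutive edges of the same kind at a vertex of \<open>S\<close>; it stops as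
  soon as it reaches a vertex outside \<open>S\<close> whose degree has come one step closer to its degree in \<open>F'\<close>.\<close>

definition trail where
  "trail S F F' x s T y t \<longleftrightarrow> T \<subseteq> flip F F' \<and> T \<noteq> {} \<and> x \<in> V \<and> y \<in> V \<and> y \<notin> S \<and> (t = 1 \<or> t = - 1)
    \<and> 0 < t * (deg F' y - deg F y - (if y = x then s else 0))
    \<and> (\<forall>v. v \<notin> S \<longrightarrow> deg (flip F T) v = deg F v + (if v = x then s else 0) + (if v = y then t else 0))
    \<and> (\<forall>v \<in> S. (even (deg (flip F T) v + deg F v) \<longleftrightarrow> v \<noteq> x)
          \<and> min (deg F v) (deg F' v) \<le> deg (flip F T) v
          \<and> deg (flip F T) v \<le> max (deg F v) (deg F' v))"

lemma trailD:
  assumes "trail S F F' x s T y t"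
  shows "T \<subseteq> flip F F'" "T \<noteq> {}" "x \<in> V" "y \<in> V" "y \<notin> S" "t = 1 \<or> t = - 1"
    "0 < t * (deg F' y - deg F y - (if y = x then s else 0))"
    "v \<notin> S \<Longrightarrow> deg (flip F T) v = deg F v + (if v = x then s else 0) + (if v = y then t else 0)"
    "v \<in> S \<Longrightarrow> even (deg (flip F T) v + deg F v) \<longleftrightarrow> v \<noteq> x"
    "v \<in> S \<Longrightarrow> min (deg F v) (deg F' v) \<le> deg (flip F T) v"
    "v \<in> S \<Longrightarrow> deg (flip F T) v \<le> max (deg F v) (deg F' v)"
  using assms unfolding trail_def by blast+

text \<open>Induction on the size of the symmetric difference: flip an edge \<open>{x, w}\<close>
  that brings the degree at \<open>x\<close> closer to \<open>F'\<close>, then stop at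
  \<open>w\<close> or restart there. The current start is the only vertex where parities may differ
  on \<open>S\<close>; the flip passes this role from \<open>x\<close> to \<open>w\<close>.\<close>

lemma exchange:
  assumes "F \<subseteq> E" "F' \<subseteq> E" "s = 1 \<or> s = - 1" "0 < s * (deg F' x - deg F x)"
    and "\<And>v. v \<in> S \<Longrightarrow> even (deg F v + deg F' v) \<longleftrightarrow> v \<noteq> x"
  shows "\<exists>T y t. trail S F F' x s T y t"
  using assms
proof (induction "card (flip F F')" arbitrary: F x s rule: less_induct)
  case less
  have fin: "finite F" "finite F'" using less.prems finite_sub by auto
  have "\<exists>e \<in> flip F F'. x \<in> e \<and> (if e \<in> F then - 1 else 1) = s"
  proof (cases "s = 1")
    case True
    then obtain e where "e \<in> F' - F" "x \<in> e"
      using ex_edge_of_deg_less[OF fin(1), of x F'] less.prems(4) by auto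
    then show ?thesis using True by (intro bexI[of _ e]) (auto simp: flip_def)
  next
    case False
    then have s: "s = - 1" using less.prems(3) by blast
    then obtain e where "e \<in> F - F'" "x \<in> e"
      using ex_edge_of_deg_less[OF fin(2), of x F] less.prems(4) by auto
    then show ?thesis using s by (intro bexI[of _ e]) (auto simp: flip_def)
  qed
  then obtain e where e: "e \<in> flip F F'" "x \<in> e" "(if e \<in> F then - 1 else 1) = s" by blast
  then have "e \<in> E" using less.prems by (auto simp: flip_def)
  then obtain w where w: "e = {x, w}" "w \<noteq> x" "w \<in> V" "x \<in> V"
    using edge_at e(2) by blast
  define F1 where "F1 = flip F {e}"
  have d1: "deg F1 v = deg F v + (if v = x then s else 0) + (if v = w then s else 0)" for v
    unfolding F1_def deg_flip_edge[OF fin(1)] using e(3) w(1,2) by auto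
  have odd_s: "odd s" using less.prems(3) by auto
  show ?case
  proof (cases "w \<notin> S \<and> 0 < s * (deg F' w - deg F w)")
    case True
    have "\<forall>v \<in> S. (even (deg F1 v + deg F v) \<longleftrightarrow> v \<noteq> x)
          \<and> min (deg F v) (deg F' v) \<le> deg F1 v \<and> deg F1 v \<le> max (deg F v) (deg F' v)"
      using True less.prems(3,4) odd_s by (auto simp: d1)
    then show ?thesis
      using True e(1) w d1 less.prems(3) odd_s unfolding F1_def trail_def
      by (intro exI[of _ "{e}"] exI[of _ w] exI[of _ s]) auto
  next
    case False
    \<comment> \<open>A step that is not towards \<open>F'\<close> is undone at \<open>w\<close> by
      the opposite change of degree. A step towards \<open>F'\<close> occurs here only for
      \<open>w\<close> in \<open>S\<close> and is followed by a second change of the same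
      sign.\<close>
    define r where "r = (if 0 < s * (deg F' w - deg F w) then s else - s)"
    have F1: "flip F1 F' = flip F F' - {e}" unfolding F1_def using e(1) by (auto simp: flip_def)
    have less_card: "card (flip F1 F') < card (flip F F')"
      unfolding F1 by (rule psubset_card_mono) (use e(1) fin in \<open>auto simp: flip_def\<close>)
    have F1_sub: "F1 \<subseteq> E" unfolding F1_def using e(1) less.prems by (auto simp: flip_def)
    have pos: "0 < r * (deg F' w - deg F1 w)"
    proof (cases "0 < s * (deg F' w - deg F w)")
      case True
      \<comment> \<open>Equal parities mean that the degrees at \<open>w\<close> differ by at least
        two, so one step does not yet reach \<open>F'\<close>.\<close>
      then have "even (deg F w + deg F' w)" using False less.prems(5)[of w] w(2) by auto
      then have "deg F' w \<noteq> deg F w + s" using neq_add_odd[OF odd_s] by blast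
      then show ?thesis using True less.prems(3) w(2) by (auto simp: r_def d1)
    next
      case False
      then show ?thesis using less.prems(3) w(2) by (auto simp: r_def d1)
    qed
    have r: "r = 1 \<or> r = - 1" using less.prems(3) by (auto simp: r_def)
    have par: "even (deg F1 v + deg F' v) \<longleftrightarrow> v \<noteq> w" if "v \<in> S" for v
      using less.prems(5)[OF that] w(2) odd_s by (auto simp: d1)
    obtain T y t where IH: "trail S F1 F' w r T y t"
      using less.hyps[OF less_card F1_sub less.prems(2) r pos par] by blast
    note T = trailD[OF IH]
    have eq: "flip F (insert e T) = flip F1 T"
      using T(1) e(1) unfolding F1 by (auto simp: F1_def flip_def)
    have rw: "r = - s" if "w \<notin> S" using False that by (simp add: r_def)
    have "deg (flip F1 T) v = deg F v + (if v = x then s else 0) + (if v = y then t else 0)"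
      if "v \<notin> S" for v
      using T(8)[OF that] d1[of v] w(2) rw that by auto
    moreover have "(even (deg (flip F1 T) v + deg F v) \<longleftrightarrow> v \<noteq> x)
        \<and> min (deg F v) (deg F' v) \<le> deg (flip F1 T) v
        \<and> deg (flip F1 T) v \<le> max (deg F v) (deg F' v)" if "v \<in> S" for v
    proof -
      consider "v = x" | "v = w" | "v \<noteq> x" "v \<noteq> w" by blast
      then show ?thesis
      proof cases
        case 1
        then have "deg F1 v = deg F v + s" using d1[of v] w(2) by simp
        then show ?thesis using T(9-11)[OF that] 1 w(2) less.prems(3,4) odd_s by auto
      next
        case 2
        then have d: "deg F1 v = deg F v + s" using d1[of v] w(2) by simp
        have "even (deg (flip F1 T) v + deg F v)"
          using T(9-11)[OF that] 2 even_add_shift[OF odd_s d] by blast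
        \<comment> \<open>If the first step was not towards \<open>F'\<close>, then
          \<open>deg F v + s\<close> is the only value outside the required interval that the
          induction hypothesis allows; parity rules it out.\<close>
        moreover from this have "deg (flip F1 T) v \<noteq> deg F v + s"
          using neq_add_odd[OF odd_s] by (metis add.commute)
        ultimately show ?thesis using T(9-11)[OF that] 2 w(2) less.prems(3) d by auto
      next
        case 3
        then have "deg F1 v = deg F v" using d1[of v] by simp
        then show ?thesis using T(9-11)[OF that] 3 by auto
      qed
    qed
    moreover have "0 < t * (deg F' y - deg F y - (if y = x then s else 0))"
    proof -
      have "deg F' y - deg F1 y - (if y = w then r else 0) = deg F' y - deg F y - (if y = x then s else 0)"
        using rw T(5) by (auto simp: d1)
      then show ?thesis using T(7) by (simp only:)
    qed
    moreover have "insert e T \<subseteq> flip F F'" using T(1) e(1) unfolding F1 by auto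
    ultimately have "trail S F F' x s (insert e T) y t"
      unfolding trail_def eq using T(4,5,6) w(4) by blast
    then show ?thesis by blast
  qed
qed

section \<open>Exchanges between optimal subgraphs\<close>

definition odd_low :: "'a set set \<Rightarrow> 'a \<Rightarrow> bool" where
  "odd_low F v \<longleftrightarrow> odd (deg F v) \<and> deg F v < k v"

lemma penalty_odd_low: "odd_low F v \<Longrightarrow> penalty (k v) (deg F v) = 0"
  by (simp add: odd_low_def penalty_def)

lemma flip_sub: "F \<subseteq> E \<Longrightarrow> G \<subseteq> E \<Longrightarrow> T \<subseteq> flip F G \<Longrightarrow> flip F T \<subseteq> E \<and> flip G T \<subseteq> E"
  by (auto simp: flip_def)

lemma flip_card:
  assumes "F \<subseteq> E" "G \<subseteq> E" "T \<subseteq> flip F G" "T \<noteq> {}"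
  shows "card (flip (flip F T) G) < card (flip F G)"
proof -
  have "flip (flip F T) G = flip F G - T" using assms(3) by (auto simp: flip_def)
  moreover have "finite (flip F G)" using assms finite_sub by (auto simp: flip_def)
  ultimately show ?thesis using assms(3,4) by (metis Diff_disjoint Diff_subset inf.orderE psubsetI psubset_card_mono)
qed

text \<open>Take for \<open>S\<close> the vertices that are odd and below the bound in both
  subgraphs. There the trail keeps both degrees odd and below the bound, and elsewhere its inner
  vertices keep their degrees, so only the two ends affect \<open>nab\<close>, in both
  subgraphs.\<close>

lemma exchange_nabla:
  assumes sub: "F \<subseteq> E" "F' \<subseteq> E" and s: "s = 1 \<or> s = - 1" "0 < s * (deg F' x - deg F x)"
    and x: "\<not> (odd_low F x \<and> odd_low F' x)"
  obtains T y t where "flip F T \<subseteq> E" "flip F' T \<subseteq> E" "card (flip (flip F T) F') < card (flip F F')"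
    "x \<in> V" "y \<in> V" "\<not> (odd_low F y \<and> odd_low F' y)" "t = 1 \<or> t = - 1"
    "0 < t * (deg F' y - deg F y - (if y = x then s else 0))"
    "\<And>v. v = x \<or> v = y \<Longrightarrow> deg (flip F T) v = deg F v + (if v = x then s else 0) + (if v = y then t else 0)"
    "\<And>v. v = x \<or> v = y \<Longrightarrow> deg (flip F' T) v = deg F' v - (if v = x then s else 0) - (if v = y then t else 0)"
    "nab (flip F T) = nab F + (\<Sum>v\<in>{x, y}. penalty (k v) (deg (flip F T) v) - penalty (k v) (deg F v))"
    "nab (flip F' T) = nab F' + (\<Sum>v\<in>{x, y}. penalty (k v) (deg (flip F' T) v) - penalty (k v) (deg F' v))"
proof -
  define S where "S = {v. odd_low F v \<and> odd_low F' v}"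
  have par: "even (deg F v + deg F' v) \<longleftrightarrow> v \<noteq> x" if "v \<in> S" for v
    using that x by (auto simp: S_def odd_low_def)
  obtain T y t where tr: "trail S F F' x s T y t"
    using exchange[OF sub s par] by blast
  note T = trailD[OF tr]
  have bal: "deg (flip F T) v + deg (flip F' T) v = deg F v + deg F' v" for v
    
    by (rule deg_flip_balance[OF _ _ T(1)]) (use finite_sub sub in auto)
  have xy: "x \<in> V" "y \<in> V" "x \<notin> S" "y \<notin> S" using T(3-5) x by (auto simp: S_def)
  have d: "deg (flip F T) v = deg F v + (if v = x then s else 0) + (if v = y then t else 0)" if "v \<notin> S" for v
    by (rule T(8)[OF that])
  have d': "deg (flip F' T) v = deg F' v - (if v = x then s else 0) - (if v = y then t else 0)" if "v \<notin> S" for v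
    using d[OF that] bal[of v] by linarith
  have odd_low: "odd_low (flip F T) v \<and> odd_low (flip F' T) v \<and> odd_low F v \<and> odd_low F' v" if "v \<in> S" for v
  proof -
    have "v \<noteq> x" using that xy by auto
    then have a: "even (deg (flip F T) v + deg F v)" "deg (flip F T) v \<le> max (deg F v) (deg F' v)"
      "min (deg F v) (deg F' v) \<le> deg (flip F T) v"
      using T(9-11)[OF that] by auto
    have b: "odd (deg F v)" "odd (deg F' v)" "deg F v < k v" "deg F' v < k v"
      using that by (auto simp: S_def odd_low_def)
    have "odd (deg (flip F T) v)" using a(1) b(1) by simp
    moreover from this have "odd (deg (flip F' T) v)" using bal[of v] b(1,2) by presburger
    moreover have "deg (flip F T) v < k v" "deg (flip F' T) v < k v"
      using a(2,3) b(3,4) bal[of v] by linarith+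
    ultimately show ?thesis using b by (simp add: odd_low_def)
  qed
  have "nab (flip F T) = nab F + (\<Sum>v\<in>{x, y}. penalty (k v) (deg (flip F T) v) - penalty (k v) (deg F v))"
  proof (rule nab_change)
    fix v assume "v \<in> V - {x, y}"
    then show "penalty (k v) (deg (flip F T) v) = penalty (k v) (deg F v)"
      using odd_low[of v] d[of v] by (cases "v \<in> S") (simp_all add: penalty_odd_low)
  qed (use xy in auto)
  moreover have "nab (flip F' T) = nab F' + (\<Sum>v\<in>{x, y}. penalty (k v) (deg (flip F' T) v) - penalty (k v) (deg F' v))"
  proof (rule nab_change)
    fix v assume "v \<in> V - {x, y}"
    then show "penalty (k v) (deg (flip F' T) v) = penalty (k v) (deg F' v)"
      using odd_low[of v] d'[of v] by (cases "v \<in> S") (simp_all add: penalty_odd_low)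
  qed (use xy in auto)
  moreover have "flip F T \<subseteq> E" "flip F' T \<subseteq> E" "card (flip (flip F T) F') < card (flip F F')"
    using flip_sub[OF sub T(1)] flip_card[OF sub T(1,2)] by auto
  moreover have "\<not> (odd_low F y \<and> odd_low F' y)" using xy(4) by (simp add: S_def)
  ultimately show ?thesis
    using that[of T y t, OF _ _ _ xy(1,2) _ T(6,7)] d d' xy(3,4) by blast
qed

text \<open>Descent: if \<open>deg F' x\<close> is at least \<open>k x\<close>, an exchange raising
  the degree at \<open>x\<close> in \<open>F\<close> yields an optimal subgraph closer to
  \<open>F'\<close> with a low vertex that again is not below its bound in
  \<open>F'\<close>.\<close>

lemma degree_less_if_low:
  assumes "opt F" "opt F'" "low F x"
  shows "deg F' x < k x"
  using assms
proof (induction "card (flip F F')" arbitrary: F x rule: less_induct)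
  case less
  show ?case
  proof (rule ccontr)
    assume "\<not> deg F' x < k x"
    then have ge: "deg F' x \<ge> k x" by simp
    note F = optD[OF less.prems(1)] and F' = optD[OF less.prems(2)]
    have lo: "even (deg F x)" "deg F x < k x" using less.prems(3) by (auto simp: low_def)
    have pos: "0 < 1 * (deg F' x - deg F x)" using ge lo by simp
    have nx: "\<not> (odd_low F x \<and> odd_low F' x)" using lo by (simp add: odd_low_def)
    obtain T y t where sub: "flip F T \<subseteq> E" "flip F' T \<subseteq> E" "card (flip (flip F T) F') < card (flip F F')"
      and V: "x \<in> V" "y \<in> V" and y: "\<not> (odd_low F y \<and> odd_low F' y)" and t: "t = 1 \<or> t = - 1"
      and pos_y: "0 < t * (deg F' y - deg F y - (if y = x then 1 else 0))"
      and d: "\<And>v. v = x \<or> v = y \<Longrightarrow> deg (flip F T) v = deg F v + (if v = x then 1 else 0) + (if v = y then t else 0)"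
      and d': "\<And>v. v = x \<or> v = y \<Longrightarrow> deg (flip F' T) v = deg F' v - (if v = x then 1 else 0) - (if v = y then t else 0)"
      and n: "nab (flip F T) = nab F + (\<Sum>v\<in>{x, y}. penalty (k v) (deg (flip F T) v) - penalty (k v) (deg F v))"
      and n': "nab (flip F' T) = nab F' + (\<Sum>v\<in>{x, y}. penalty (k v) (deg (flip F' T) v) - penalty (k v) (deg F' v))"
      by (rule exchange_nabla[of F F' 1 x]) (use F F' pos nx in auto)
    have m: "m \<le> nab (flip F T)" "m \<le> nab (flip F' T)" using m_le sub by auto
    have kx: "even (k x)" and ky: "even (k y)" using k_props V by auto
    have "opt (flip F T) \<and> (if y = x then low (flip F T) x else low (flip F T) y \<and> deg F' y \<ge> k y)"
    proof (cases "y = x")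
      case True
      \<comment> \<open>A closed trail raises the degree at \<open>x\<close> by 2, and minimality
        leaves \<open>x\<close> low.\<close>
      then have t1: "t = 1" using t pos_y ge lo by auto
      have dx: "deg (flip F T) x = deg F x + 2" using d[of x] True t1 by simp
      then have "nab (flip F T) = nab F + (penalty (k x) (deg F x + 2) - penalty (k x) (deg F x))"
        using n True by simp
      then have nab: "nab (flip F T) = m + penalty (k x) (deg F x + 2) - 1"
        using F lo by (simp add: penalty_def)
      then have "1 \<le> penalty (k x) (deg F x + 2)" using m by simp
      note p = penalty_plus_2[OF kx lo this]
      have "opt (flip F T)" using optI[OF sub(1)] nab p(2) by simp
      moreover have "low (flip F T) x" unfolding low_def dx using p(1) lo by simp
      ultimately show ?thesis using True by simp
    next
      case False
      have "nab (flip F T) = nab F + (penalty (k x) (deg F x + 1) - penalty (k x) (deg F x))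
          + (penalty (k y) (deg F y + t) - penalty (k y) (deg F y))"
        using n d False by simp
      then have 1: "nab (flip F T) = m - 1 + (penalty (k y) (deg F y + t) - penalty (k y) (deg F y))"
        using F lo unfolding penalty_up[OF kx] by simp
      have "nab (flip F' T) = nab F' + (penalty (k x) (deg F' x - 1) - penalty (k x) (deg F' x))
          + (penalty (k y) (deg F' y - t) - penalty (k y) (deg F' y))"
        using n' d' False by simp
      then have 2: "m \<le> m + (if deg F' x > k x then - 1 else 0)
          + (penalty (k y) (deg F' y - t) - penalty (k y) (deg F' y))"
        using F' ge m unfolding penalty_down[OF kx] by (auto split: if_splits)
      have py: "0 < t * (deg F' y - deg F y)" using pos_y False by simp
      have dy: "deg (flip F T) y = deg F y + t" using d[of y] False by simp
      \<comment> \<open>The gain at \<open>x\<close> in \<open>F\<close> must be lost at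
        \<open>y\<close>, and the change at \<open>y\<close> in \<open>F'\<close> may not be a gain.
        As \<open>y\<close> is not \<open>odd_low\<close> in both subgraphs, only
        \<open>deg F' y = k y\<close> remains.\<close>
      have "t = 1 \<and> nab (flip F T) = m \<and> low (flip F T) y \<and> deg F' y \<ge> k y"
      proof (cases "t = 1")
        case True
        have a: "odd (deg F y)" "deg F y + 1 < k y" "nab (flip F T) = m" if "\<not> deg F y \<ge> k y"
          using 1 m that unfolding True penalty_up[OF ky] by (auto split: if_splits)
        have b: "deg F' y = k y \<or> deg F' y < k y \<and> odd (deg F' y)"
          using 2 unfolding True penalty_down[OF ky] by (auto split: if_splits)
        have "\<not> deg F y \<ge> k y" using b py True by auto
        then show ?thesis using a b y True dy by (auto simp: odd_low_def low_def)
      next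
        case False
        then have t: "t = - 1" using t by auto
        have a: "odd (deg F y)" "deg F y < k y"
          using 1 m penalty_down[OF ky, of "deg F y"] unfolding t by (auto split: if_splits)
        have "odd (deg F' y)"
          using 2 penalty_up[OF ky, of "deg F' y"] py a unfolding t by (auto split: if_splits)
        then show ?thesis using y a py t by (auto simp: odd_low_def)
      qed
      then show ?thesis using False sub by (auto intro!: optI)
    qed
    then obtain z where "opt (flip F T)" "low (flip F T) z" "deg F' z \<ge> k z"
      using ge by (cases "y = x") auto
    then show False using less.hyps[OF sub(3) _ less.prems(2), of z] by simp
  qed
qed

text \<open>A trail lowering the degree at \<open>x\<close> in \<open>F\<close> gains 1 there, so
  its other end loses 1 in \<open>F\<close>. The same trail then gains 1 at that end in
  \<open>F'\<close>, so flipping it in \<open>F'\<close> keeps optimality and makes \<open>x\<close>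
  low.\<close>

lemma low_if_odd_low_and_excess:
  assumes "opt F" "opt F'" "deg F x > k x" "odd_low F' x"
  shows "\<exists>G. opt G \<and> low G x"
proof -
  note F = optD[OF assms(1)] and F' = optD[OF assms(2)]
  have ol: "odd (deg F' x)" "deg F' x < k x" using assms(4) by (auto simp: odd_low_def)
  have pos: "0 < - 1 * (deg F' x - deg F x)" using assms(3) ol by simp
  have nx: "\<not> (odd_low F x \<and> odd_low F' x)" using assms(3) by (simp add: odd_low_def)
  obtain T y t where sub: "flip F T \<subseteq> E" "flip F' T \<subseteq> E"
    and V: "x \<in> V" "y \<in> V" and y: "\<not> (odd_low F y \<and> odd_low F' y)" and t: "t = 1 \<or> t = - 1"
    and pos_y: "0 < t * (deg F' y - deg F y - (if y = x then - 1 else 0))"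
    and d: "\<And>v. v = x \<or> v = y \<Longrightarrow> deg (flip F T) v = deg F v + (if v = x then - 1 else 0) + (if v = y then t else 0)"
    and d': "\<And>v. v = x \<or> v = y \<Longrightarrow> deg (flip F' T) v = deg F' v - (if v = x then - 1 else 0) - (if v = y then t else 0)"
    and n: "nab (flip F T) = nab F + (\<Sum>v\<in>{x, y}. penalty (k v) (deg (flip F T) v) - penalty (k v) (deg F v))"
    and n': "nab (flip F' T) = nab F' + (\<Sum>v\<in>{x, y}. penalty (k v) (deg (flip F' T) v) - penalty (k v) (deg F' v))"
    by (rule exchange_nabla[of F F' "- 1" x]) (use F F' pos nx in auto)
  have m: "m \<le> nab (flip F T)" "m \<le> nab (flip F' T)" using m_le sub by auto
  have kx: "even (k x)" and ky: "even (k y)" using k_props V by auto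
  \<comment> \<open>A closed trail would lower the degree at \<open>x\<close> by 2 and so improve
    \<open>F\<close>.\<close>
  have "y \<noteq> x"
  proof
    assume yx: "y = x"
    then have "t = - 1" using t pos_y assms(3) ol by auto
    then have "nab (flip F T) = nab F + (penalty (k x) (deg F x - 2) - penalty (k x) (deg F x))"
      using n d[of x] yx by simp
    then have "penalty (k x) (deg F x) \<le> penalty (k x) (deg F x - 2)" using m F by simp
    then show False using penalty_minus_2[OF kx assms(3)] by simp
  qed
  have "nab (flip F T) = nab F + (penalty (k x) (deg F x - 1) - penalty (k x) (deg F x))
      + (penalty (k y) (deg F y + t) - penalty (k y) (deg F y))"
    using n d \<open>y \<noteq> x\<close> by simp
  then have 1: "nab (flip F T) = m - 1 + (penalty (k y) (deg F y + t) - penalty (k y) (deg F y))"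
    using F assms(3) unfolding penalty_down[OF kx] by simp
  have "nab (flip F' T) = nab F' + (penalty (k x) (deg F' x + 1) - penalty (k x) (deg F' x))
      + (penalty (k y) (deg F' y - t) - penalty (k y) (deg F' y))"
    using n' d' \<open>y \<noteq> x\<close> by simp
  then have 2: "nab (flip F' T) = m + (if deg F' x + 1 = k x then 0 else 1)
      + (penalty (k y) (deg F' y - t) - penalty (k y) (deg F' y))"
    using F' ol unfolding penalty_up[OF kx] by simp
  have py: "0 < t * (deg F' y - deg F y)" using pos_y \<open>y \<noteq> x\<close> by simp
  have dy: "deg (flip F T) y = deg F y + t" using d[of y] \<open>y \<noteq> x\<close> by simp
  have dx: "deg (flip F' T) x = deg F' x + 1" using d'[of x] \<open>y \<noteq> x\<close> by simp
  have a: "t = 1 \<and> deg F y \<ge> k y \<or> odd_low F y \<and> low (flip F T) y \<and> nab (flip F T) = m"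
  proof (cases "t = 1")
    case True
    then show ?thesis
      using 1 m dy unfolding True penalty_up[OF ky] by (auto simp: odd_low_def low_def split: if_splits)
  next
    case False
    then have t: "t = - 1" using t by auto
    then show ?thesis
      using 1 m dy penalty_down[OF ky, of "deg F y"] by (auto simp: odd_low_def low_def split: if_splits)
  qed
  \<comment> \<open>In the only case without a gain for \<open>F'\<close> at \<open>y\<close>,
    \<open>deg F' y = k y\<close> and \<open>y\<close> is low in the optimal
    \<open>flip F T\<close>; \<open>degree_less_if_low\<close> excludes this.\<close>
  have "deg F' y \<noteq> k y \<or> deg F y \<ge> k y"
    using a degree_less_if_low[of "flip F T" F' y] assms(2) optI sub(1) by fastforce
  moreover have "penalty (k y) (deg F' y - t) - penalty (k y) (deg F' y) = - 1" if "deg F' y \<noteq> k y \<or> deg F y \<ge> k y"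
  proof (cases "t = 1")
    case True
    then show ?thesis
      using that y a py penalty_down[OF ky, of "deg F' y"] by (auto simp: odd_low_def split: if_splits)
  next
    case False
    then have t: "t = - 1" using t by auto
    then show ?thesis
      using that y a py penalty_up[OF ky, of "deg F' y"] by (auto simp: odd_low_def split: if_splits)
  qed
  ultimately have "deg F' x + 1 < k x \<and> nab (flip F' T) = m"
    using 2 m ol by (auto split: if_splits)
  then have "opt (flip F' T) \<and> low (flip F' T) x"
    using sub(2) dx ol by (auto simp: low_def intro!: optI)
  then show ?thesis by blast
qed

section \<open>Moving low vertices like tokens inside \<open>X\<close>\<close>

definition X :: "'a set" where
  "X = {v \<in> V. \<exists>F. opt F \<and> low F v}"

lemma X_deg_less: "opt F \<Longrightarrow> v \<in> X \<Longrightarrow> deg F v < k v"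
  using degree_less_if_low by (auto simp: X_def)

text \<open>Adding or deleting an edge at the low \<open>x\<close> gains exactly 1 there, so only
  the other end decides whether the result is optimal.\<close>

lemma flip_edge:
  assumes "opt F" "low F x" "{x, y} \<in> E" and s_def: "s = (if {x, y} \<in> F then - 1 else 1)"
  shows "s = 1 \<or> s = - 1" "x \<noteq> y" "y \<in> V" "flip F {{x, y}} \<subseteq> E"
    "deg (flip F {{x, y}}) v = deg F v + (if v = x \<or> v = y then s else 0)"
    "nab (flip F {{x, y}}) = m - 1 + (penalty (k y) (deg F y + s) - penalty (k y) (deg F y))"
proof -
  show s: "s = 1 \<or> s = - 1" by (simp add: s_def)
  obtain w where w: "{x, y} = {x, w}" "w \<noteq> x" "w \<in> V" "x \<in> V" by (rule edge_at[OF assms(3), of x]) auto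
  then show xy: "x \<noteq> y" "y \<in> V" by auto
  show "flip F {{x, y}} \<subseteq> E" using optD[OF assms(1)] assms(3) by (auto simp: flip_def)
  show "deg (flip F {{x, y}}) v = deg F v + (if v = x \<or> v = y then s else 0)" for v
    unfolding s_def using deg_flip_edge[OF finite_sub, of F "{x, y}" v] optD[OF assms(1)] by auto
  note d = this
  have "nab (flip F {{x, y}}) = nab F + (\<Sum>v\<in>{x, y}. penalty (k v) (deg (flip F {{x, y}}) v) - penalty (k v) (deg F v))"
    by (rule nab_change) (use xy w d in auto)
  also have "\<dots> = m + (penalty (k x) (deg F x + s) - penalty (k x) (deg F x)) + (penalty (k y) (deg F y + s) - penalty (k y) (deg F y))"
    using xy optD[OF assms(1)] d[of x] d[of y] by simp
  also have "\<dots> = m - 1 + (penalty (k y) (deg F y + s) - penalty (k y) (deg F y))"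
    using odd_penalty_step(1,2)[of "k x" "deg F x" s] s k_props[OF w(4)] assms(2)
    by (simp add: low_def)
  finally show "nab (flip F {{x, y}}) = m - 1 + (penalty (k y) (deg F y + s) - penalty (k y) (deg F y))" .
qed

text \<open>Minimality forces a loss of 1 at \<open>y\<close>, whose degree is below
  \<open>k y\<close> because \<open>y\<close> lies in \<open>X\<close>. A low \<open>y\<close> would
  gain, so its degree is odd; reaching \<open>k y\<close> would cost nothing, so the new even degree
  stays below \<open>k y\<close>.\<close>

lemma move:
  assumes "opt F" "low F x" "{x, y} \<in> E" "y \<in> X"
  shows "\<not> low F y" "opt (flip F {{x, y}})" "low (flip F {{x, y}}) y"
proof -
  define s where "s = (if {x, y} \<in> F then - 1 else 1 :: int)"
  note s = flip_edge(1)[OF assms(1-3) s_def] and y = flip_edge(3)[OF assms(1-3) s_def]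
    and sub = flip_edge(4)[OF assms(1-3) s_def] and d = flip_edge(5)[OF assms(1-3) s_def]
    and n = flip_edge(6)[OF assms(1-3) s_def]
  have ky: "even (k y)" using k_props y by auto
  have lt: "deg F y < k y" using X_deg_less assms by blast
  have m: "m \<le> nab (flip F {{x, y}})" using m_le sub by blast
  have dy: "deg (flip F {{x, y}}) y = deg F y + s" using d[of y] by simp
  have odd: "odd (deg F y)"
    using m n odd_penalty_step(1,2)[of "k y" "deg F y" s] ky lt s by auto
  then show "\<not> low F y" by (simp add: low_def)
  have "\<not> (s = 1 \<and> deg F y + 1 = k y)"
    using m n lt odd by (auto simp: penalty_def)
  then have lt': "deg F y + s < k y" using lt s by auto
  have ev: "even (deg F y + s)" using odd s by auto
  have "nab (flip F {{x, y}}) \<le> m"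
    using n lt lt' odd ev by (auto simp: penalty_def)
  then show "opt (flip F {{x, y}})" using optI sub by blast
  show "low (flip F {{x, y}}) y" unfolding low_def dy using ev lt' by blast
qed

text \<open>Below \<open>k y\<close> the forced loss of 1 at \<open>y\<close> would make
  \<open>y\<close> low in an optimal subgraph, against \<open>y \<notin> X\<close>. From
  \<open>k y\<close> on, only an added edge causes a loss.\<close>

lemma edge_leaving_X:
  assumes "opt F" "low F x" "{x, y} \<in> E" "y \<notin> X"
  shows "{x, y} \<notin> F" "opt (flip F {{x, y}})" "deg (flip F {{x, y}}) y > k y"
proof -
  define s where "s = (if {x, y} \<in> F then - 1 else 1 :: int)"
  note s = flip_edge(1)[OF assms(1-3) s_def] and y = flip_edge(3)[OF assms(1-3) s_def]
    and sub = flip_edge(4)[OF assms(1-3) s_def] and d = flip_edge(5)[OF assms(1-3) s_def]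
    and n = flip_edge(6)[OF assms(1-3) s_def]
  have ky: "even (k y)" using k_props y by auto
  have m: "m \<le> nab (flip F {{x, y}})" using m_le sub by blast
  have dy: "deg (flip F {{x, y}}) y = deg F y + s" using d[of y] by simp
  have "\<not> low F y" "\<not> (opt (flip F {{x, y}}) \<and> low (flip F {{x, y}}) y)"
    using assms(1,4) y by (auto simp: X_def)
  then have nl: "deg F y \<ge> k y \<or> odd (deg F y)"
    and nl': "nab (flip F {{x, y}}) \<le> m \<Longrightarrow> deg F y + s \<ge> k y \<or> odd (deg F y + s)"
    using optI[OF sub] dy by (auto simp: low_def)
  have *: "s = 1 \<and> deg F y \<ge> k y"
  proof (cases "s = 1")
    case True
    then show ?thesis using m n nl nl' penalty_up[OF ky, of "deg F y"] by (auto split: if_splits)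
  next
    case False
    then have "s = - 1" using s by blast
    then show ?thesis using m n nl nl' penalty_down[OF ky, of "deg F y"] by (auto split: if_splits)
  qed
  then show "{x, y} \<notin> F" by (auto simp: s_def split: if_splits)
  have "nab (flip F {{x, y}}) \<le> m" using n * penalty_up[OF ky, of "deg F y"] by simp
  then show "opt (flip F {{x, y}})" using optI sub by blast
  show "deg (flip F {{x, y}}) y > k y" using dy * by simp
qed

text \<open>Each move flips an edge inside \<open>Y\<close>, so the membership of any other edge can
  be decided after bringing the token to one of its ends.\<close>

lemma move_path:
  assumes "(v, u) \<in> (adjacency (induced_edges E Y))\<^sup>*" "Y \<subseteq> X" "opt F" "low F v"
  shows "\<exists>G. opt G \<and> low G u \<and> (\<forall>e. \<not> e \<subseteq> Y \<longrightarrow> e \<in> G \<longleftrightarrow> e \<in> F)"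
  using assms(1)
proof induction
  case base
  then show ?case using assms(3,4) by blast
next
  case (step y z)
  then obtain G where G: "opt G" "low G y" "\<forall>e. \<not> e \<subseteq> Y \<longrightarrow> e \<in> G \<longleftrightarrow> e \<in> F" by blast
  have yz: "{y, z} \<in> E" "{y, z} \<subseteq> Y" using step(2) by (auto simp: adjacency_def induced_edges_def)
  then have "opt (flip G {{y, z}})" "low (flip G {{y, z}}) z"
    using move(2,3)[OF G(1,2) yz(1)] assms(2) by auto
  moreover have "\<forall>e. \<not> e \<subseteq> Y \<longrightarrow> e \<in> flip G {{y, z}} \<longleftrightarrow> e \<in> F"
    using G(3) yz(2) unfolding flip_def by blast
  ultimately show ?case by blast
qed

text \<open>Moving the token from \<open>v\<close> along the path leaves the one at \<open>u\<close>
  in place, so eventually two low vertices would be adjacent, which \<open>move\<close>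
  forbids.\<close>

lemma unique_low:
  assumes "(v, u) \<in> (adjacency (induced_edges E X))\<^sup>*" "opt F" "low F v" "low F u"
  shows "v = u"
  using assms
proof (induction arbitrary: F rule: converse_rtrancl_induct)
  case base
  then show ?case by simp
next
  case (step y z)
  have yz: "{y, z} \<in> E" "z \<in> X" using step(1) by (auto simp: adjacency_def induced_edges_def)
  note mv = move[OF step(4,5) yz]
  show ?case
  proof (rule ccontr)
    assume "y \<noteq> u"
    moreover have "z \<noteq> u" using mv(1) step(6) by auto
    ultimately have "deg (flip F {{y, z}}) u = deg F u"
      using deg_flip_edge[OF finite_sub, of F "{y, z}" u] optD[OF step(4)] by auto
    then have "low (flip F {{y, z}}) u" using step(6) by (simp add: low_def)
    then have "z = u" using step(3)[OF mv(2,3)] by blast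
    then show False using \<open>z \<noteq> u\<close> by blast
  qed
qed

section \<open>The decomposition in terms of \<open>X\<close>\<close>

abbreviation I where "I \<equiv> I_H V E (H_of f)"
abbreviation A where "A \<equiv> A_H V E (H_of f)"
abbreviation B where "B \<equiv> B_H V E (H_of f)"
abbreviation C where "C \<equiv> C_H V E (H_of f)"
abbreviation D where "D \<equiv> D_H V E (H_of f)"

lemma finite_I: "finite (I v)" and I_nonempty: "I v \<noteq> {}" 
proof -
  have "I v \<subseteq> {..card E}"
    using optD finite_E by (auto simp: I_H_def degree_def intro!: card_mono)
  then show "finite (I v)" by (rule finite_subset) simp
  show "I v \<noteq> {}" using ex_opt by (auto simp: I_H_def)
qed

lemma mem_H_of: "v \<in> V \<Longrightarrow> d \<in> H_of f v \<longleftrightarrow> d = f v \<or> odd d \<and> d < f v"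
  using f_ge[of v] by (auto simp: H_of_def)

lemma finite_H_of: "finite (H_of f v)"
  by (rule finite_subset[of _ "{..f v}"]) (auto simp: H_of_def)

lemma Max_H_of: "Max (H_of f v) = f v"
  by (rule Max_eqI) (use finite_H_of in \<open>auto simp: H_of_def\<close>)

lemma Min_H_of: "v \<in> V \<Longrightarrow> Min (H_of f v) = 1"
  using f_ge[of v] by (intro Min_eqI finite_H_of) (auto simp: H_of_def intro: Suc_leI odd_pos)

text \<open>A low degree is inadmissible and below the maximum. Conversely, if \<open>v\<close> is
  never low, an inadmissible optimal degree exceeds \<open>f v\<close>; then
  \<open>low_if_odd_low_and_excess\<close> keeps all optimal degrees at least \<open>f v\<close>,
  which puts \<open>v\<close> into \<open>A\<close>.\<close>

lemma X_iff: "v \<in> X \<longleftrightarrow> v \<in> V \<and> v \<notin> A \<and> v \<notin> C"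
proof (cases "v \<in> V")
  case V: True
  note mem = mem_H_of[OF V]
  show ?thesis
  proof (cases "v \<in> X")
    case True
    then obtain F where F: "opt F" "low F v" by (auto simp: X_def)
    then have "degree F v \<in> I v" "degree F v < f v" "even (degree F v)" by (auto simp: I_H_def low_def)
    then have "v \<notin> C" "Min (I v) < f v"
      using finite_I I_nonempty by (auto simp: mem C_H_def Min_less_iff)
    then show ?thesis using True V by (auto simp: A_H_def Max_H_of)
  next
    case False
    have "v \<in> A" if notC: "v \<notin> C"
    proof -
      obtain F where F: "opt F" "degree F v \<notin> H_of f v"
        using notC V by (auto simp: C_H_def I_H_def)
      moreover have "\<not> low F v" using False F V by (auto simp: X_def)
      ultimately have excess: "deg F v > k v" by (auto simp: mem low_def)
      have "\<not> odd_low G v" if "opt G" for G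
        using low_if_odd_low_and_excess[OF F(1) that excess] False V by (auto simp: X_def)
      moreover have "\<not> low G v" if "opt G" for G using False that V by (auto simp: X_def)
      ultimately have "degree G v \<ge> f v" if "opt G" for G
        using that by (force simp: low_def odd_low_def)
      then have "Min (I v) \<ge> f v" using finite_I I_nonempty by (auto simp: I_H_def)
      then show ?thesis using notC V by (simp add: A_H_def Max_H_of)
    qed
    then show ?thesis using False by blast
  qed
qed (simp add: X_def)

text \<open>The bound 1 is the minimum of \<open>H_of f v\<close>. It lies below \<open>f v\<close>,
  so a vertex obeying it cannot belong to \<open>A\<close>.\<close>

lemma B_iff: "v \<in> B \<longleftrightarrow> v \<in> X \<and> (\<forall>F. opt F \<longrightarrow> degree F v \<le> 1)"
proof (cases "v \<in> V")
  case V: True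
  have *: "Max (I v) \<le> 1 \<longleftrightarrow> (\<forall>F. opt F \<longrightarrow> degree F v \<le> 1)"
    using finite_I I_nonempty by (auto simp: I_H_def)
  have "v \<notin> A" if "Max (I v) \<le> 1"
  proof -
    have "Min (I v) \<le> Max (I v)" using finite_I I_nonempty by simp
    then show ?thesis using that f_ge[OF V] by (auto simp: A_H_def Max_H_of)
  qed
  then show ?thesis using V * by (auto simp: X_iff B_H_def Min_H_of)
qed (simp add: X_iff B_H_def)

lemma D_eq: "D = X - B"
  by (auto simp: D_H_def X_iff)

lemma D_Un_B: "D \<union> B = X"
  using B_iff by (auto simp: D_eq)

text \<open>A low vertex of \<open>B\<close> has degree 0, so flipping adds the edge. For
  \<open>y\<close> in \<open>B\<close> the new degree of \<open>y\<close> is at most 1, so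
  \<open>y\<close> was low before, next to the low \<open>x\<close>. For \<open>y\<close> in
  \<open>C\<close> the new degree exceeds \<open>f y\<close> and is inadmissible.\<close>

lemma no_edge_B:
  assumes "{x, y} \<in> E" "x \<in> B" "y \<in> B \<union> C"
  shows False
proof -
  obtain F where F: "opt F" "low F x" using assms(2) B_iff by (auto simp: X_def)
  have "degree F x \<le> 1" using assms(2) F(1) B_iff by blast
  then have x0: "degree F x = 0" using F(2) by (cases "degree F x") (auto simp: low_def)
  have fin: "finite F" using F(1) optD finite_sub by blast
  then have "{x, y} \<notin> F" using x0 by (auto simp: degree_def)
  then have d: "deg (flip F {{x, y}}) y = deg F y + 1" using deg_flip_edge[OF fin] by auto
  show False
  proof (cases "y \<in> B")
    case True
    then have "y \<in> X" using B_iff by blast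
    note mv = move[OF F assms(1) this]
    have yV: "y \<in> V" using \<open>y \<in> X\<close> by (simp add: X_def)
    have "degree (flip F {{x, y}}) y \<le> 1" using True mv(2) B_iff by blast
    then have "deg F y = 0" using d by linarith
    then have "low F y" using k_props[OF yV] by (simp add: low_def)
    then show False using mv(1) by blast
  next
    case False
    then have y: "y \<in> C" using assms(3) by blast
    then have "y \<notin> X" using X_iff by blast
    note lv = edge_leaving_X[OF F assms(1) this]
    have "degree (flip F {{x, y}}) y \<in> H_of f y" using y lv(2) by (auto simp: C_H_def I_H_def)
    then show False using lv(3) y by (auto simp: H_of_def)
  qed
qed

section \<open>Parity of the components\<close>

lemma boundary_edge:
  assumes "opt F" "low F x" "{x, y} \<in> F" "y \<notin> X"
  shows False
  using edge_leaving_X(1)[OF assms(1,2) _ assms(4)] assms(3) optD[OF assms(1)] by blast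

text \<open>Adding the edge would give \<open>y\<close> degree at most 1; then \<open>y\<close> was
  low beside the low \<open>x\<close>, which \<open>move\<close> forbids.\<close>

lemma edge_to_B:
  assumes "opt F" "low F x" "{x, y} \<in> E" "y \<in> B"
  shows "{x, y} \<in> F"
proof (rule ccontr)
  assume "{x, y} \<notin> F"
  have fin: "finite F" using assms(1) optD finite_sub by blast
  then have d: "deg (flip F {{x, y}}) y = deg F y + 1"
    using deg_flip_edge[OF fin] \<open>{x, y} \<notin> F\<close> by auto
  have y: "y \<in> X" using assms(4) B_iff by blast
  note mv = move[OF assms(1-3) y]
  have "degree (flip F {{x, y}}) y \<le> 1" using mv(2) assms(4) B_iff by blast
  then have "deg F y = 0" using d by linarith
  then have "low F y" using k_props[of y] y by (simp add: low_def X_def)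
  then show False using mv(1) by blast
qed

lemma adjacency_induced_mono: "Y \<subseteq> Z \<Longrightarrow> adjacency (induced_edges E Y) \<subseteq> adjacency (induced_edges E Z)"
  by (auto simp: adjacency_def induced_edges_def)

text \<open>Covers both parity statements: \<open>B - Y\<close> is \<open>B\<close> for
  \<open>Y = D\<close> and empty for \<open>Y = D \<union> B\<close>. With the token at
  \<open>v\<close> in \<open>R\<close>, all other degrees in \<open>R\<close> are odd, and
  \<open>F\<close> leaves \<open>R\<close> exactly along the edges to \<open>B - Y\<close>.\<close>

lemma component_parity:
  assumes R: "R \<in> induced_components E Y" and Y: "Y = D \<or> Y = D \<union> B"
  shows "odd (card R + card (edges_between E R (B - Y)))"
proof -
  let ?adj = "adjacency (induced_edges E Y)"
  have YX: "Y \<subseteq> X" and XYB: "X - Y = B - Y" using Y D_Un_B by auto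
  obtain v where v: "v \<in> Y" and R_def: "R = {u \<in> Y. (v, u) \<in> ?adj\<^sup>*}"
    using R by (auto simp: components_def)
  obtain F where F: "opt F" "low F v" using v YX by (auto simp: X_def)
  have FE: "F \<subseteq> E" using optD F by blast
  have "Y \<subseteq> V" using YX by (auto simp: X_def)
  then have finR: "finite R" unfolding R_def using finite_V finite_subset by fastforce
  have vR: "v \<in> R" using v by (simp add: R_def)
  have "{u \<in> R. odd (degree F u)} = R - {v}"
  proof -
    have "odd (degree F u)" if "u \<in> R" "u \<noteq> v" for u
    proof -
      have "(v, u) \<in> (adjacency (induced_edges E X))\<^sup>*"
        using that(1) rtrancl_mono[OF adjacency_induced_mono[OF YX]] by (auto simp: R_def)
      then have "\<not> low F u" using unique_low[OF _ F] that(2) by blast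
      moreover have "deg F u < k u" using X_deg_less[OF F(1)] that(1) YX by (auto simp: R_def)
      ultimately show ?thesis by (simp add: low_def)
    qed
    then show ?thesis using F(2) by (auto simp: low_def)
  qed
  then have "even (\<Sum>u\<in>R. degree F u) \<longleftrightarrow> even (card (R - {v}))"
    using even_sum_iff[OF finR, of "degree F"] by simp
  moreover have "even (\<Sum>u\<in>R. degree F u) \<longleftrightarrow> even (card {e \<in> F. card (e \<inter> R) = 1})"
    using FE finR finite_sub card_edge by (intro even_sum_degree_iff) auto
  moreover have "card R = Suc (card (R - {v}))" by (rule card.remove[OF finR vR])
  moreover have "{e \<in> F. card (e \<inter> R) = 1} = edges_between E R (B - Y)"
  proof (intro equalityI subsetI)
    fix e assume "e \<in> {e \<in> F. card (e \<inter> R) = 1}"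
    then have e: "e \<in> F" "e \<in> E" "card (e \<inter> R) = 1" using FE by auto
    then obtain x where x: "e \<inter> R = {x}" by (auto simp: card_1_singleton_iff)
    then have xe: "x \<in> e" "x \<in> R" by auto
    obtain y where y: "e = {x, y}" "y \<noteq> x" by (rule edge_at[OF e(2) xe(1)])
    then have "y \<notin> R" using x by auto
    have vx: "(v, x) \<in> ?adj\<^sup>*" using xe by (simp add: R_def)
    have "y \<notin> Y"
    proof
      assume "y \<in> Y"
      then have "(x, y) \<in> ?adj" using e(2) y xe by (auto simp: adjacency_def induced_edges_def R_def)
      then have "(v, y) \<in> ?adj\<^sup>*" using vx by (rule rtrancl_into_rtrancl[rotated])
      then show False using \<open>y \<notin> R\<close> \<open>y \<in> Y\<close> by (simp add: R_def)
    qed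
    \<comment> \<open>Since \<open>e\<close> is not contained in \<open>Y\<close>, bringing the
      token to \<open>x\<close> does not affect whether \<open>e\<close> is chosen.\<close>
    obtain G where G: "opt G" "low G x" "\<forall>e. \<not> e \<subseteq> Y \<longrightarrow> e \<in> G \<longleftrightarrow> e \<in> F"
      using move_path[OF vx YX F] by blast
    have "{x, y} \<in> G" using G(3) e(1) y \<open>y \<notin> Y\<close> by blast
    then have "y \<in> X" using boundary_edge[OF G(1,2)] by blast
    then have "y \<in> B - Y" using XYB \<open>y \<notin> Y\<close> by blast
    then show "e \<in> edges_between E R (B - Y)" using e(2) y xe by (auto simp: edges_between_def)
  next
    fix e assume "e \<in> edges_between E R (B - Y)"
    then obtain x y where e: "e \<in> E" "e = {x, y}" "x \<in> R" "y \<in> B" "y \<notin> Y"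
      by (auto simp: edges_between_def)
    have vx: "(v, x) \<in> ?adj\<^sup>*" using e by (simp add: R_def)
    obtain G where G: "opt G" "low G x" "\<forall>e. \<not> e \<subseteq> Y \<longrightarrow> e \<in> G \<longleftrightarrow> e \<in> F"
      using move_path[OF vx YX F] by blast
    have "e \<in> G" using edge_to_B[OF G(1,2)] e by blast
    then have "e \<in> F" using G(3) e by blast
    moreover have "e \<inter> R = {x}" using e by (auto simp: R_def)
    ultimately show "e \<in> {e \<in> F. card (e \<inter> R) = 1}" by simp
  qed
  ultimately show ?thesis by auto
qed

end

theorem theorem8:
  fixes V :: "'a set" and E :: "'a set set" and f :: "'a \<Rightarrow> nat"
  assumes graph: "finite_simple_graph V E"
    and f_even: "\<And>v. v \<in> V \<Longrightarrow> even (f v)"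
    and f_ge: "\<And>v. v \<in> V \<Longrightarrow> f v \<ge> 4"
  defines "B \<equiv> B_H V E (H_of f)"
    and "C \<equiv> C_H V E (H_of f)"
    and "D \<equiv> D_H V E (H_of f)"
  shows "edges_between E B (B \<union> C) = {}
    \<and> (\<forall>R \<in> induced_components E D. (card R + card (edges_between E R B)) mod 2 = 1)
    \<and> (\<forall>R \<in> induced_components E (D \<union> B). odd (card R))"
proof -
  interpret even_bound_graph V E f
    using graph f_even f_ge by unfold_locales
  have "edges_between E B (B \<union> C) = {}"
    using no_edge_B by (auto simp: B_def C_def edges_between_def)
  moreover have "(card R + card (edges_between E R B)) mod 2 = 1" if "R \<in> induced_components E D" for R
  proof -
    have "B - D = B" unfolding B_def D_def using D_eq by blast
    then have "odd (card R + card (edges_between E R B))"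
      using component_parity[of R D] that unfolding B_def D_def by simp
    then show ?thesis by (simp only: odd_iff_mod_2_eq_one)
  qed
  moreover have "odd (card R)" if "R \<in> induced_components E (D \<union> B)" for R
  proof -
    have "edges_between E R (B - (D \<union> B)) = {}" by (auto simp: edges_between_def)
    then show ?thesis
      using component_parity[of R "D \<union> B"] that unfolding B_def D_def by simp
  qed
  ultimately show ?thesis by blast
qed

end
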